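(* Let $G=(U,V,E)$ be a finite bipartite graph, $w:E\to\mathbb{R}_{\ge 0}$ and $b:U\cup V\to\mathbb{Z}_{\ge 0}$, defining a constrained bipartite $b$-matching game. Let $(u,v,z)\in\mathbb{R}^U\times\mathbb{R}^V\times\mathbb{R}^E$ be an optimal solution to the linear program $$\min \sum_{i\in U}b_iu_i+\sum_{j\in V}b_jv_j+\sum_{(i,j)\in E}z_{ij}\quad\text{s.t.}\quad u_i+v_j+z_{ij}\ge w_{ij}\ \ \forall (i,j)\in E,\quad u_i,v_j,z_{ij}\ge 0\ \ \forall i\in U,\ j\in V,\ (i,j)\in E.$$ Then all profit-sharing methods $(\alpha,\beta)$ corresponding to $(u,v,z)$ are imputations in the core of the constrained bipartite $b$-matching game; that is, for every choice of non-negative reals $c_{ij},d_{ij}$ with $z_{ij}=c_{ij}+d_{ij}$ for all $(i,j)\in E$, the pair $(\alpha,\beta)$ given by $$\alpha_i=b_iu_i+\sum_{j:(i,j)\in E}c_{ij}\ \ (i\in U),\qquad \beta_j=b_jv_j+\sum_{i:(i,j)\in E}d_{ij}\ \ (j\in V)$$ is an imputation in the core.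
   Context: Constrained bipartite $b$-matching game: the players are the vertices $U\cup V$. A (constrained) $b$-matching is a set of edges (each edge is matched at most once) such that each vertex $q$ is incident to at most $b_q$ chosen edges; its weight is the sum of the weights of its edges. The worth $p(S_u\cup S_v)$ of a coalition $S_u\cup S_v$ ($S_u\subseteq U,S_v\subseteq V$) is the weight of a maximum weight such $b$-matching in the subgraph of $G$ induced on $S_u\cup S_v$. An imputation is a pair of functions $\alpha:U\to\mathbb{R}_{\ge 0}$, $\beta:V\to\mathbb{R}_{\ge 0}$ with $\sum_{i\in U}\alpha_i+\sum_{j\in V}\beta_j=p(U\cup V)$. It is in the core if $\sum_{i\in S_u}\alpha_i+\sum_{j\in S_v}\beta_j\ge p(S_u\cup S_v)$ for every coalition $S_u\cup S_v$. *)

theory Defs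
  imports Complex_Main
begin

text \<open>
  The two sides of a bipartite graph are disjoint sets of vertices of one type; an edge between
  \<open>i \<in> U\<close> and \<open>j \<in> V\<close> is represented by the pair \<open>(i, j)\<close>. Vectors indexed by
  vertices or edges are total functions whose values off the index set are irrelevant.
\<close>

definition bipartite_graph :: "'v set \<Rightarrow> 'v set \<Rightarrow> ('v \<times> 'v) set \<Rightarrow> bool" where
  "bipartite_graph U V E \<longleftrightarrow>
     finite U \<and> finite V \<and> U \<inter> V = {} \<and> E \<subseteq> U \<times> V"

definition b_matching ::
  "'v set \<Rightarrow> 'v set \<Rightarrow> ('v \<times> 'v) set \<Rightarrow> ('v \<Rightarrow> nat) \<Rightarrow> ('v \<times> 'v) set \<Rightarrow> bool" where
  "b_matching U V E b M \<longleftrightarrow>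
     M \<subseteq> E \<and> (\<forall>q\<in>U \<union> V. card {e \<in> M. fst e = q \<or> snd e = q} \<le> b q)"

definition max_b_matching_weight ::
  "'v set \<Rightarrow> 'v set \<Rightarrow> ('v \<times> 'v) set \<Rightarrow> ('v \<times> 'v \<Rightarrow> real) \<Rightarrow> ('v \<Rightarrow> nat) \<Rightarrow> real" where
  "max_b_matching_weight U V E w b = Max {(\<Sum>e\<in>M. w e) | M. b_matching U V E b M}"

text \<open>The maximum is over a finite set if \<open>E\<close> is finite, nonempty because of the empty matching.\<close>

definition worth ::
  "('v \<times> 'v) set \<Rightarrow> ('v \<times> 'v \<Rightarrow> real) \<Rightarrow> ('v \<Rightarrow> nat) \<Rightarrow> 'v set \<Rightarrow> 'v set \<Rightarrow> real" where
  "worth E w b Su Sv = max_b_matching_weight Su Sv (E \<inter> Su \<times> Sv) w b"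

definition imputation ::
  "'v set \<Rightarrow> 'v set \<Rightarrow> ('v \<times> 'v) set \<Rightarrow> ('v \<times> 'v \<Rightarrow> real) \<Rightarrow> ('v \<Rightarrow> nat) \<Rightarrow>
   ('v \<Rightarrow> real) \<Rightarrow> ('v \<Rightarrow> real) \<Rightarrow> bool" where
  "imputation U V E w b \<alpha> \<beta> \<longleftrightarrow>
     (\<forall>i\<in>U. \<alpha> i \<ge> 0) \<and> (\<forall>j\<in>V. \<beta> j \<ge> 0) \<and>
     (\<Sum>i\<in>U. \<alpha> i) + (\<Sum>j\<in>V. \<beta> j) = worth E w b U V"

definition in_core ::
  "'v set \<Rightarrow> 'v set \<Rightarrow> ('v \<times> 'v) set \<Rightarrow> ('v \<times> 'v \<Rightarrow> real) \<Rightarrow> ('v \<Rightarrow> nat) \<Rightarrow>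
   ('v \<Rightarrow> real) \<Rightarrow> ('v \<Rightarrow> real) \<Rightarrow> bool" where
  "in_core U V E w b \<alpha> \<beta> \<longleftrightarrow>
     imputation U V E w b \<alpha> \<beta> \<and>
     (\<forall>Su Sv. Su \<subseteq> U \<longrightarrow> Sv \<subseteq> V \<longrightarrow>
        (\<Sum>i\<in>Su. \<alpha> i) + (\<Sum>j\<in>Sv. \<beta> j) \<ge> worth E w b Su Sv)"

definition dual_feasible ::
  "'v set \<Rightarrow> 'v set \<Rightarrow> ('v \<times> 'v) set \<Rightarrow> ('v \<times> 'v \<Rightarrow> real) \<Rightarrow>
   ('v \<Rightarrow> real) \<Rightarrow> ('v \<Rightarrow> real) \<Rightarrow> ('v \<times> 'v \<Rightarrow> real) \<Rightarrow> bool" where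
  "dual_feasible U V E w u v z \<longleftrightarrow>
     (\<forall>(i, j)\<in>E. u i + v j + z (i, j) \<ge> w (i, j)) \<and>
     (\<forall>i\<in>U. u i \<ge> 0) \<and> (\<forall>j\<in>V. v j \<ge> 0) \<and> (\<forall>e\<in>E. z e \<ge> 0)"

definition dual_objective ::
  "'v set \<Rightarrow> 'v set \<Rightarrow> ('v \<times> 'v) set \<Rightarrow> ('v \<Rightarrow> nat) \<Rightarrow>
   ('v \<Rightarrow> real) \<Rightarrow> ('v \<Rightarrow> real) \<Rightarrow> ('v \<times> 'v \<Rightarrow> real) \<Rightarrow> real" where
  "dual_objective U V E b u v z =
     (\<Sum>i\<in>U. real (b i) * u i) + (\<Sum>j\<in>V. real (b j) * v j) + (\<Sum>e\<in>E. z e)"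

definition dual_optimal ::
  "'v set \<Rightarrow> 'v set \<Rightarrow> ('v \<times> 'v) set \<Rightarrow> ('v \<times> 'v \<Rightarrow> real) \<Rightarrow> ('v \<Rightarrow> nat) \<Rightarrow>
   ('v \<Rightarrow> real) \<Rightarrow> ('v \<Rightarrow> real) \<Rightarrow> ('v \<times> 'v \<Rightarrow> real) \<Rightarrow> bool" where
  "dual_optimal U V E w b u v z \<longleftrightarrow>
     dual_feasible U V E w u v z \<and>
     (\<forall>u' v' z'. dual_feasible U V E w u' v' z' \<longrightarrow>
        dual_objective U V E b u v z \<le> dual_objective U V E b u' v' z')"

definition profit_sharing_method ::
  "'v set \<Rightarrow> 'v set \<Rightarrow> ('v \<times> 'v) set \<Rightarrow> ('v \<Rightarrow> nat) \<Rightarrow>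
   ('v \<Rightarrow> real) \<Rightarrow> ('v \<Rightarrow> real) \<Rightarrow> ('v \<times> 'v \<Rightarrow> real) \<Rightarrow>
   ('v \<Rightarrow> real) \<Rightarrow> ('v \<Rightarrow> real) \<Rightarrow> bool" where
  "profit_sharing_method U V E b u v z \<alpha> \<beta> \<longleftrightarrow>
     (\<exists>c d :: 'v \<times> 'v \<Rightarrow> real.
        (\<forall>e\<in>E. c e \<ge> 0 \<and> d e \<ge> 0 \<and> z e = c e + d e) \<and>
        (\<forall>i\<in>U. \<alpha> i = real (b i) * u i + (\<Sum>j | (i, j) \<in> E. c (i, j))) \<and>
        (\<forall>j\<in>V. \<beta> j = real (b j) * v j + (\<Sum>i | (i, j) \<in> E. d (i, j))))"

end

theory Submission
  imports Defs
begin

text \<open>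
  Weak duality, applied to the subgraph induced by a coalition, gives the core inequalities; what
  remains is that the dual optimum is the weight of a maximum weight \<open>b\<close>-matching \<open>M\<close>. Complementary
  slackness with respect to \<open>M\<close> asks for \<open>u, v \<ge> 0\<close> with \<open>u\<^sub>i + v\<^sub>j \<le> w\<^sub>i\<^sub>j\<close> on \<open>M\<close>,
  \<open>u\<^sub>i + v\<^sub>j \<ge> w\<^sub>i\<^sub>j\<close> off \<open>M\<close>, and value \<open>0\<close> at unsaturated vertices. After the substitution
  \<open>v \<mapsto> - v\<close> these are difference constraints, that is, a potential on a residual digraph with an
  extra root. A negative simple cycle in that digraph would augment \<open>M\<close> to a heavier \<open>b\<close>-matching,
  so shortest path distances provide the potential.
\<close>

section \<open>Potentials in digraphs without negative cycles\<close>

text \<open>Used to cut a path at a vertex \<open>a\<close> it visits: \<open>a\<close> stays on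
  both sides, so no arc is lost.\<close>

lemma zip_tl_append_Cons:
  "zip (p @ a # q) (tl (p @ a # q)) = zip (p @ [a]) (tl (p @ [a])) @ zip (a # q) q"
proof (induction p)
  case (Cons x p)
  then show ?case by (cases p) auto
qed simp

lemma zip_tl_snoc:
  "p \<noteq> [] \<Longrightarrow> zip (p @ [a]) (tl (p @ [a])) = zip p (tl p) @ [(last p, a)]"
proof (induction p)
  case (Cons x p)
  then show ?case by (cases p) auto
qed simp

text \<open>For \<open>b = a\<close> the left-hand side lists the arcs of the closed walk through
  \<open>a # p\<close>; the closing arc is split off.\<close>

lemma zip_Cons_snoc: "zip (a # p) (p @ [b]) = zip (a # p) p @ [(last (a # p), b)]"
  by (induction p arbitrary: a) auto

lemma single_valued_set_zip:
  assumes "distinct xs"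
  shows "single_valued (set (zip xs ys))"
  using assms by (auto simp: single_valued_def set_zip nth_eq_iff_index_eq)

lemma single_valued_converse_set_zip:
  assumes "distinct ys"
  shows "single_valued ((set (zip xs ys))\<inverse>)"
  using assms by (auto simp: single_valued_def set_zip nth_eq_iff_index_eq)

text \<open>The potential is the length of a shortest simple path ending at a given vertex, with
  arbitrary start. Cycles enter as arc sets with at most one arc leaving and one entering each
  vertex, so users of the lemma need not handle lists.\<close>

lemma potential_exists:
  fixes A :: "('a \<times> 'a) set" and c :: "'a \<times> 'a \<Rightarrow> real"
  assumes fin: "finite A"
    and nonneg: "\<And>C. C \<subseteq> A \<Longrightarrow> single_valued C \<Longrightarrow> single_valued (C\<inverse>) \<Longrightarrow>
      Domain C = Range C \<Longrightarrow> 0 \<le> (\<Sum>e\<in>C. c e)"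
  obtains y where "\<And>a a'. (a, a') \<in> A \<Longrightarrow> y a' \<le> y a + c (a, a')"
proof -
  define arcs :: "'a list \<Rightarrow> ('a \<times> 'a) list" where "arcs p = zip p (tl p)" for p
  define len where "len p = sum_list (map c (arcs p))" for p
  \<comment> \<open>Distinct lists over the finite set \<open>Field A\<close> are finitely many, and
    \<open>[a]\<close> is one of them for \<open>a\<close> in \<open>Field A\<close>, so the minimum
    in \<open>y a\<close> is attained there.\<close>
  define P where "P a = {p. p \<noteq> [] \<and> distinct p \<and> set p \<subseteq> Field A \<and> set (arcs p) \<subseteq> A \<and> last p = a}"
    for a
  define y where "y a = Min (len ` P a)" for a
  have "finite (Field A)" using fin by (rule finite_Field)
  then have finP: "finite (P a)" for a
    by (rule finite_subset[rotated, OF finite_subset_distinct]) (auto simp: P_def)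
  have "y a' \<le> y a + c (a, a')" if aa': "(a, a') \<in> A" for a a'
  proof -
    have "[a] \<in> P a" using aa' by (auto simp: P_def arcs_def Field_def)
    then have "y a \<in> len ` P a" unfolding y_def using finP by (intro Min_in) auto
    then obtain p where p: "p \<in> P a" "y a = len p" by auto
    \<comment> \<open>Append \<open>a'\<close> to \<open>p\<close>, or, if \<open>p\<close> already
      visits \<open>a'\<close>, cut it back to there: the part removed closes up with
      \<open>(a, a')\<close> to a cycle, whose length is nonnegative.\<close>
    have "\<exists>q\<in>P a'. len q \<le> len p + c (a, a')"
    proof (cases "a' \<in> set p")
      case False
      have "p @ [a'] \<in> P a' \<and> len (p @ [a']) = len p + c (a, a')"
        using p aa' False zip_tl_snoc[of p a']
        by (auto simp: P_def arcs_def len_def Field_def simp del: tl_append2)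
      then show ?thesis by (intro bexI[of _ "p @ [a']"]) auto
    next
      case True
      then obtain p1 p2 where split: "p = p1 @ a' # p2" by (meson split_list)
      have arcs: "arcs p = arcs (p1 @ [a']) @ zip (a' # p2) p2"
        unfolding arcs_def split by (rule zip_tl_append_Cons)
      have last: "last (a' # p2) = a" using p split by (auto simp: P_def)
      have cyc: "zip (a' # p2) (p2 @ [a']) = zip (a' # p2) p2 @ [(a, a')]"
        unfolding zip_Cons_snoc last ..
      define C where "C = set (zip (a' # p2) (p2 @ [a']))"
      have dist: "distinct (a' # p2)" "distinct (p2 @ [a'])" using p split by (auto simp: P_def)
      have "Domain C = set (a' # p2)" "Range C = set (p2 @ [a'])"
        by (simp_all add: C_def Domain_fst Range_snd flip: set_map)
      moreover have "C \<subseteq> A" using p arcs aa' cyc by (auto simp: C_def P_def)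
      ultimately have "0 \<le> (\<Sum>e\<in>C. c e)"
        using dist unfolding C_def
        by (intro nonneg single_valued_set_zip single_valued_converse_set_zip) auto
      also have "\<dots> = sum_list (map c (zip (a' # p2) (p2 @ [a'])))"
        unfolding C_def using dist by (intro sum.distinct_set_conv_list distinct_zipI1)
      also have "\<dots> = sum_list (map c (zip (a' # p2) p2)) + c (a, a')"
        unfolding cyc by simp
      finally have "len (p1 @ [a']) \<le> len p + c (a, a')"
        unfolding len_def arcs by simp
      moreover have "p1 @ [a'] \<in> P a'"
        using p arcs split by (auto simp: P_def)
      ultimately show ?thesis by auto
    qed
    moreover have "y a' \<le> len q" if "q \<in> P a'" for q
      unfolding y_def using finP that by (intro Min_le) auto
    ultimately show ?thesis unfolding p(2) by (meson order_trans)
  qed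
  then show thesis by (rule that)
qed

section \<open>Weak duality\<close>

lemma bipartite_graph_induced:
  assumes "bipartite_graph U V E" "Su \<subseteq> U" "Sv \<subseteq> V"
  shows "bipartite_graph Su Sv (E \<inter> Su \<times> Sv)"
  using assms by (auto simp: bipartite_graph_def intro: finite_subset)

lemma bipartite_graph_finite:
  assumes "bipartite_graph U V E"
  shows "finite U" "finite V" "finite E"
  using assms by (auto simp: bipartite_graph_def intro: finite_subset)

text \<open>As the sides are disjoint, a vertex of \<open>U\<close> is never a second component of
  an edge, nor one of \<open>V\<close> a first. Degrees can then be bounded one side at a
  time.\<close>

lemma incident_eq:
  assumes "bipartite_graph U V E" "M \<subseteq> E"
  shows "q \<in> U \<Longrightarrow> {e \<in> M. fst e = q \<or> snd e = q} = {e \<in> M. fst e = q}"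
    and "q \<in> V \<Longrightarrow> {e \<in> M. fst e = q \<or> snd e = q} = {e \<in> M. snd e = q}"
  using assms by (fastforce simp: bipartite_graph_def)+

lemma b_matching_iff:
  assumes "bipartite_graph U V E"
  shows "b_matching U V E b M \<longleftrightarrow> M \<subseteq> E \<and>
    (\<forall>i\<in>U. card {e \<in> M. fst e = i} \<le> b i) \<and> (\<forall>j\<in>V. card {e \<in> M. snd e = j} \<le> b j)"
  using incident_eq[OF assms] by (auto simp: b_matching_def ball_Un)

text \<open>With \<open>g\<close> taken as \<open>fst\<close> or \<open>snd\<close>, this turns
  vertex prices summed over matched edges into prices weighted by matched degrees.\<close>

lemma sum_fibres:
  fixes f :: "'b \<Rightarrow> real"
  assumes "finite M" "finite T" "g ` M \<subseteq> T"
  shows "(\<Sum>e\<in>M. f (g e)) = (\<Sum>q\<in>T. real (card {e \<in> M. g e = q}) * f q)"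
  using sum.group[OF assms, of "\<lambda>e. f (g e)"] by simp

lemma max_b_matching_weight_attained:
  assumes "finite E"
  obtains M where "b_matching U V E b M" "max_b_matching_weight U V E w b = (\<Sum>e\<in>M. w e)"
    and "\<And>M'. b_matching U V E b M' \<Longrightarrow> (\<Sum>e\<in>M'. w e) \<le> (\<Sum>e\<in>M. w e)"
proof -
  let ?S = "{(\<Sum>e\<in>M. w e) | M. b_matching U V E b M}"
  have eq: "?S = sum w ` {M. b_matching U V E b M}" by auto
  have "{M. b_matching U V E b M} \<subseteq> Pow E" by (auto simp: b_matching_def)
  then have fin: "finite ?S"
    unfolding eq using assms by (meson finite_Pow_iff finite_imageI finite_subset)
  have "b_matching U V E b {}" by (simp add: b_matching_def)
  then have "?S \<noteq> {}" by blast
  from Min_in Max_in[OF fin this] obtain M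
    where M: "b_matching U V E b M" "Max ?S = (\<Sum>e\<in>M. w e)" by blast
  have "(\<Sum>e\<in>M'. w e) \<le> (\<Sum>e\<in>M. w e)" if "b_matching U V E b M'" for M'
    unfolding M(2)[symmetric] using that by (intro Max_ge[OF fin]) blast
  then show thesis using M that unfolding max_b_matching_weight_def by blast
qed

lemma sum_edges_by_vertex:
  fixes f :: "'v \<times> 'v \<Rightarrow> real"
  assumes "bipartite_graph U V E"
  shows "(\<Sum>i\<in>U. \<Sum>j | (i, j) \<in> E. f (i, j)) = (\<Sum>e\<in>E. f e)"
    and "(\<Sum>j\<in>V. \<Sum>i | (i, j) \<in> E. f (i, j)) = (\<Sum>e\<in>E. f e)"
proof -
  note fin = bipartite_graph_finite[OF assms]
  have sub: "fst ` E \<subseteq> U" "snd ` E \<subseteq> V" using assms by (auto simp: bipartite_graph_def)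
  have "(\<Sum>j | (i, j) \<in> E. f (i, j)) = (\<Sum>e | e \<in> E \<and> fst e = i. f e)" for i
    by (rule sum.reindex_bij_witness[of _ snd "Pair i"]) auto
  then show "(\<Sum>i\<in>U. \<Sum>j | (i, j) \<in> E. f (i, j)) = (\<Sum>e\<in>E. f e)"
    using sum.group[OF fin(3,1) sub(1)] by simp
  have "(\<Sum>i | (i, j) \<in> E. f (i, j)) = (\<Sum>e | e \<in> E \<and> snd e = j. f e)" for j
    by (rule sum.reindex_bij_witness[of _ fst "\<lambda>i. (i, j)"]) auto
  then show "(\<Sum>j\<in>V. \<Sum>i | (i, j) \<in> E. f (i, j)) = (\<Sum>e\<in>E. f e)"
    using sum.group[OF fin(3,2) sub(2)] by simp
qed

text \<open>Bound each matched weight by its dual constraint and regroup by end vertices; degrees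
  are at most \<open>b\<close>, and \<open>z\<close> is nonnegative off the matching.\<close>

lemma max_b_matching_weight_le_dual_objective:
  assumes bip: "bipartite_graph U V E" and feas: "dual_feasible U V E w u v z"
  shows "max_b_matching_weight U V E w b \<le> dual_objective U V E b u v z"
proof -
  note fin = bipartite_graph_finite[OF bip]
  obtain M where "b_matching U V E b M" and
    eq: "max_b_matching_weight U V E w b = (\<Sum>e\<in>M. w e)"
    using max_b_matching_weight_attained[OF fin(3)] by metis
  then have M: "M \<subseteq> E" "\<And>i. i \<in> U \<Longrightarrow> card {e \<in> M. fst e = i} \<le> b i"
    "\<And>j. j \<in> V \<Longrightarrow> card {e \<in> M. snd e = j} \<le> b j"
    by (auto simp: b_matching_iff[OF bip])
  have finM: "finite M" using M(1) fin(3) by (rule finite_subset)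
  have sub: "fst ` M \<subseteq> U" "snd ` M \<subseteq> V" using M(1) bip by (auto simp: bipartite_graph_def)
  have "(\<Sum>e\<in>M. w e) \<le> (\<Sum>e\<in>M. u (fst e) + v (snd e) + z e)"
    using M(1) feas by (intro sum_mono) (fastforce simp: dual_feasible_def)
  also have "\<dots> = (\<Sum>i\<in>U. real (card {e \<in> M. fst e = i}) * u i)
      + (\<Sum>j\<in>V. real (card {e \<in> M. snd e = j}) * v j) + (\<Sum>e\<in>M. z e)"
    using sum_fibres[OF finM fin(1) sub(1)] sum_fibres[OF finM fin(2) sub(2)]
    by (simp add: sum.distrib)
  also have "\<dots> \<le> dual_objective U V E b u v z"
    unfolding dual_objective_def using M feas fin
    by (intro add_mono sum_mono mult_right_mono sum_mono2) (auto simp: dual_feasible_def)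
  finally show ?thesis by (simp add: eq)
qed

section \<open>Strong duality\<close>

text \<open>For the edges at a vertex that loses \<open>f\<close> and gains at most
  \<open>e\<close>.\<close>

lemma card_exchange_le:
  assumes "finite D" "D' \<subseteq> insert e (D - {f})" "f \<in> D"
  shows "card D' \<le> card D"
proof -
  have "card D' \<le> card (insert e (D - {f}))" using assms(1,2) by (intro card_mono) auto
  also have "\<dots> \<le> Suc (card (D - {f}))" using assms(1) by (simp add: card_insert_if)
  also have "\<dots> = card D" using assms(1,3) by (rule card_Suc_Diff1)
  finally show ?thesis .
qed

text \<open>
  The residual digraph, with root \<open>None\<close>: the arc \<open>(x, y)\<close> of length \<open>l\<close> encodes the constraint
  \<open>\<pi> y \<le> \<pi> x + l\<close>, where \<open>\<pi>\<close> is \<open>u\<close> on \<open>U\<close>, \<open>- v\<close> on \<open>V\<close> and \<open>0\<close> at the root.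
\<close>

inductive_set residual ::
  "'v set \<Rightarrow> 'v set \<Rightarrow> ('v \<times> 'v) set \<Rightarrow> ('v \<Rightarrow> nat) \<Rightarrow> ('v \<times> 'v) set \<Rightarrow> ('v option \<times> 'v option) set"
  for U V E b M where
  backward: "(i, j) \<in> M \<Longrightarrow> (Some j, Some i) \<in> residual U V E b M"
| forward: "(i, j) \<in> E - M \<Longrightarrow> (Some i, Some j) \<in> residual U V E b M"
| from_left: "i \<in> U \<Longrightarrow> (Some i, None) \<in> residual U V E b M"
| to_right: "j \<in> V \<Longrightarrow> (None, Some j) \<in> residual U V E b M"
| to_left: "i \<in> U \<Longrightarrow> card {e \<in> M. fst e = i} < b i \<Longrightarrow> (None, Some i) \<in> residual U V E b M"
| from_right: "j \<in> V \<Longrightarrow> card {e \<in> M. snd e = j} < b j \<Longrightarrow> (Some j, None) \<in> residual U V E b M"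

text \<open>The sides are disjoint, so \<open>(x, y)\<close> and \<open>(y, x)\<close> are never
  both edges: membership of \<open>(x, y)\<close> in \<open>E\<close> tells forward arcs from
  backward ones.\<close>

fun residual_length ::
  "('v \<times> 'v) set \<Rightarrow> ('v \<times> 'v \<Rightarrow> real) \<Rightarrow> 'v option \<times> 'v option \<Rightarrow> real" where
  "residual_length E w (Some x, Some y) = (if (x, y) \<in> E then - w (x, y) else w (y, x))"
| "residual_length E w _ = 0"

lemma finite_residual:
  assumes "bipartite_graph U V E" "M \<subseteq> E"
  shows "finite (residual U V E b M)"
proof (rule finite_subset)
  let ?N = "insert None (Some ` (U \<union> V))"
  have "M \<subseteq> U \<times> V" "E \<subseteq> U \<times> V" using assms by (auto simp: bipartite_graph_def)
  then show "residual U V E b M \<subseteq> ?N \<times> ?N"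
    by (intro subrelI) (erule residual.cases; auto)
  show "finite (?N \<times> ?N)" using assms by (simp add: bipartite_graph_def)
qed

text \<open>Removing from \<open>M\<close> the edges of backward arcs in \<open>C\<close> and adding
  those of forward arcs gives a \<open>b\<close>-matching whose weight is that of \<open>M\<close>
  minus the length of \<open>C\<close>. Maximality of \<open>M\<close> makes this length
  nonnegative.\<close>

lemma residual_cycle_nonneg:
  assumes bip: "bipartite_graph U V E" and bM: "b_matching U V E b M"
    and max: "\<And>M'. b_matching U V E b M' \<Longrightarrow> (\<Sum>e\<in>M'. w e) \<le> (\<Sum>e\<in>M. w e)"
    and C: "C \<subseteq> residual U V E b M" "single_valued C" "single_valued (C\<inverse>)" "Domain C = Range C"
  shows "0 \<le> (\<Sum>a\<in>C. residual_length E w a)"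
proof -
  note fin = bipartite_graph_finite[OF bip]
  have UV: "U \<inter> V = {}" "E \<subseteq> U \<times> V" using bip by (auto simp: bipartite_graph_def)
  have M: "M \<subseteq> E" "\<And>i. i \<in> U \<Longrightarrow> card {e \<in> M. fst e = i} \<le> b i"
    "\<And>j. j \<in> V \<Longrightarrow> card {e \<in> M. snd e = j} \<le> b j"
    using bM by (auto simp: b_matching_iff[OF bip])
  have finM: "finite M" using M(1) fin(3) by (rule finite_subset)
  define R where "R = {(i, j) \<in> M. (Some j, Some i) \<in> C}"
  define F where "F = {(i, j) \<in> E - M. (Some i, Some j) \<in> C}"
  define M' where "M' = (M - R) \<union> F"
  have sub: "R \<subseteq> M" "F \<subseteq> E - M" by (auto simp: R_def F_def)
  have finR: "finite R" and finF: "finite F" using sub finM fin(3) by (auto intro: finite_subset)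

  \<comment> \<open>At most one edge is added at \<open>i\<close>, since \<open>C\<close> leaves
    \<open>i\<close> at most once. If one is added, \<open>C\<close> also enters \<open>i\<close>:
    either from \<open>V\<close>, which removes an edge at \<open>i\<close>, or from the root, which
    requires \<open>i\<close> to be unsaturated.\<close>
  have "card {e \<in> M'. fst e = i} \<le> b i" if i: "i \<in> U" for i
  proof (cases "\<exists>j. (i, j) \<in> F")
    case False
    then have "{e \<in> M'. fst e = i} \<subseteq> {e \<in> M. fst e = i}" by (auto simp: M'_def)
    then have "card {e \<in> M'. fst e = i} \<le> card {e \<in> M. fst e = i}"
      using finM by (intro card_mono) auto
    with M(2)[OF i] show ?thesis by simp
  next
    case True
    then obtain j where j: "(i, j) \<in> F" by blast
    then have inC: "(Some i, Some j) \<in> C" by (auto simp: F_def)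
    then have uniq: "j' = j" if "(i, j') \<in> F" for j'
      using that C(2) by (auto simp: F_def dest: single_valuedD)
    have "Some i \<in> Range C" using inC C(4) by blast
    then obtain x where x: "(x, Some i) \<in> C" by blast
    then have "(x, Some i) \<in> residual U V E b M" using C(1) by blast
    then consider j' where "x = Some j'" "(i, j') \<in> M" | "card {e \<in> M. fst e = i} < b i"
      by cases (use i UV in auto)
    then show ?thesis
    proof cases
      case 1
      then have "(i, j') \<in> R" using x by (auto simp: R_def)
      then have "{e \<in> M'. fst e = i} \<subseteq> insert (i, j) ({e \<in> M. fst e = i} - {(i, j')})"
        using uniq by (auto simp: M'_def)
      then have "card {e \<in> M'. fst e = i} \<le> card {e \<in> M. fst e = i}"
        using finM 1 by (intro card_exchange_le) auto
      with M(2)[OF i] show ?thesis by simp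
    next
      case 2
      have "{e \<in> M'. fst e = i} \<subseteq> insert (i, j) {e \<in> M. fst e = i}"
        using uniq by (auto simp: M'_def)
      then have "card {e \<in> M'. fst e = i} \<le> card (insert (i, j) {e \<in> M. fst e = i})"
        using finM by (intro card_mono) auto
      also have "\<dots> \<le> Suc (card {e \<in> M. fst e = i})"
        using finM by (simp add: card_insert_if)
      finally show ?thesis using 2 by simp
    qed
  qed
  \<comment> \<open>The mirror image: an added edge enters \<open>j\<close>, and the arc of
    \<open>C\<close> leaving \<open>j\<close> either removes an edge or goes to the root.\<close>
  moreover have "card {e \<in> M'. snd e = j} \<le> b j" if j: "j \<in> V" for j
  proof (cases "\<exists>i. (i, j) \<in> F")
    case False
    then have "{e \<in> M'. snd e = j} \<subseteq> {e \<in> M. snd e = j}" by (auto simp: M'_def)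
    then have "card {e \<in> M'. snd e = j} \<le> card {e \<in> M. snd e = j}"
      using finM by (intro card_mono) auto
    with M(3)[OF j] show ?thesis by simp
  next
    case True
    then obtain i where i: "(i, j) \<in> F" by blast
    then have inC: "(Some i, Some j) \<in> C" by (auto simp: F_def)
    then have uniq: "i' = i" if "(i', j) \<in> F" for i'
      using that C(3) by (auto simp: F_def single_valued_def)
    have "Some j \<in> Domain C" using inC C(4) by blast
    then obtain x where x: "(Some j, x) \<in> C" by blast
    then have "(Some j, x) \<in> residual U V E b M" using C(1) by blast
    then consider i' where "x = Some i'" "(i', j) \<in> M" | "card {e \<in> M. snd e = j} < b j"
      by cases (use j UV in auto)
    then show ?thesis
    proof cases
      case 1
      then have "(i', j) \<in> R" using x by (auto simp: R_def)
      then have "{e \<in> M'. snd e = j} \<subseteq> insert (i, j) ({e \<in> M. snd e = j} - {(i', j)})"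
        using uniq by (auto simp: M'_def)
      then have "card {e \<in> M'. snd e = j} \<le> card {e \<in> M. snd e = j}"
        using finM 1 by (intro card_exchange_le) auto
      with M(3)[OF j] show ?thesis by simp
    next
      case 2
      have "{e \<in> M'. snd e = j} \<subseteq> insert (i, j) {e \<in> M. snd e = j}"
        using uniq by (auto simp: M'_def)
      then have "card {e \<in> M'. snd e = j} \<le> card (insert (i, j) {e \<in> M. snd e = j})"
        using finM by (intro card_mono) auto
      also have "\<dots> \<le> Suc (card {e \<in> M. snd e = j})"
        using finM by (simp add: card_insert_if)
      finally show ?thesis using 2 by simp
    qed
  qed
  moreover have "M' \<subseteq> E" using M(1) sub by (auto simp: M'_def)
  ultimately have "b_matching U V E b M'" by (simp add: b_matching_iff[OF bip])
  then have "(\<Sum>e\<in>M'. w e) \<le> (\<Sum>e\<in>M. w e)" by (rule max)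
  moreover have "(\<Sum>e\<in>M'. w e) = (\<Sum>e\<in>M. w e) - (\<Sum>e\<in>R. w e) + (\<Sum>e\<in>F. w e)"
    unfolding M'_def using sub finM finF
    by (subst sum.union_disjoint) (auto simp: sum_diff)
  moreover have "(\<Sum>a\<in>C. residual_length E w a) = (\<Sum>e\<in>R. w e) - (\<Sum>e\<in>F. w e)"
  proof -
    let ?R = "(\<lambda>(i, j). (Some j, Some i)) ` R" and ?F = "(\<lambda>(i, j). (Some i, Some j)) ` F"
    have nE: "(j, i) \<notin> E" if "(i, j) \<in> E" for i j using that UV by blast
    \<comment> \<open>What remains are arcs at the root.\<close>
    have "residual_length E w a = 0" if "a \<in> C - (?R \<union> ?F)" for a
    proof -
      obtain x y where a: "a = (x, y)" by (cases a)
      then have "(x, y) \<in> residual U V E b M" using that C(1) by blast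
      then show ?thesis
      proof cases
        case (backward i j)
        then have "(i, j) \<in> R" using that a by (auto simp: R_def)
        then have "a \<in> ?R" unfolding a backward by (intro image_eqI) auto
        with that show ?thesis by blast
      next
        case (forward i j)
        then have "(i, j) \<in> F" using that a by (auto simp: F_def)
        then have "a \<in> ?F" unfolding a forward by (intro image_eqI) auto
        with that show ?thesis by blast
      qed (auto simp: a)
    qed
    moreover have "?R \<union> ?F \<subseteq> C" by (auto simp: R_def F_def)
    moreover have "finite C" using C(1) finite_residual[OF bip M(1)] by (rule finite_subset)
    ultimately have "(\<Sum>a\<in>C. residual_length E w a) = (\<Sum>a\<in>?R \<union> ?F. residual_length E w a)"
      by (intro sum.mono_neutral_right) auto
    also have "\<dots> = (\<Sum>a\<in>?R. residual_length E w a) + (\<Sum>a\<in>?F. residual_length E w a)"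
      proof (intro sum.union_disjoint)
        have "(j, i) \<notin> F" if "(i, j) \<in> R" for i j using that sub M(1) nE by blast
        then show "?R \<inter> ?F = {}" by auto
      qed (use finR finF in auto)
    also have "(\<Sum>a\<in>?R. residual_length E w a) = (\<Sum>e\<in>R. w e)"
      using sub M(1) nE by (subst sum.reindex) (auto simp: inj_on_def intro!: sum.cong)
    also have "(\<Sum>a\<in>?F. residual_length E w a) = (\<Sum>e\<in>F. - w e)"
      using sub by (subst sum.reindex) (auto simp: inj_on_def intro!: sum.cong)
    finally show ?thesis by (simp add: sum_negf)
  qed
  ultimately show ?thesis by linarith
qed

text \<open>A residual potential for a maximum \<open>M\<close> yields \<open>u\<close> and
  \<open>v\<close>; letting \<open>z\<close> absorb the slack on \<open>M\<close> makes every dual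
  constraint tight there.\<close>

lemma dual_objective_attains_max_b_matching_weight:
  assumes bip: "bipartite_graph U V E"
  obtains u v z where "dual_feasible U V E w u v z"
    and "dual_objective U V E b u v z = max_b_matching_weight U V E w b"
proof -
  note fin = bipartite_graph_finite[OF bip]
  have UV: "U \<inter> V = {}" "E \<subseteq> U \<times> V" using bip by (auto simp: bipartite_graph_def)
  obtain M where bM: "b_matching U V E b M"
    and eq: "max_b_matching_weight U V E w b = (\<Sum>e\<in>M. w e)"
    and max: "\<And>M'. b_matching U V E b M' \<Longrightarrow> (\<Sum>e\<in>M'. w e) \<le> (\<Sum>e\<in>M. w e)"
    using max_b_matching_weight_attained[OF fin(3)] by metis
  have M: "M \<subseteq> E" "\<And>i. i \<in> U \<Longrightarrow> card {e \<in> M. fst e = i} \<le> b i"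
    "\<And>j. j \<in> V \<Longrightarrow> card {e \<in> M. snd e = j} \<le> b j"
    using bM by (auto simp: b_matching_iff[OF bip])
  have finM: "finite M" using M(1) fin(3) by (rule finite_subset)
  have sub: "fst ` M \<subseteq> U" "snd ` M \<subseteq> V" using M(1) UV by auto
  obtain y where y: "\<And>a a'. (a, a') \<in> residual U V E b M \<Longrightarrow>
      y a' \<le> y a + residual_length E w (a, a')"
    using potential_exists[OF finite_residual[OF bip M(1)]
        residual_cycle_nonneg[OF bip bM max]] by blast
  \<comment> \<open>The potential is shifted to vanish at the root and its sign is flipped on
    \<open>V\<close>.\<close>
  define u where "u i = y (Some i) - y None" for i
  define v where "v j = y None - y (Some j)" for j
  define z where "z e = (if e \<in> M then w e - u (fst e) - v (snd e) else 0)" for e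
  have u: "0 \<le> u i" if "i \<in> U" for i
    using y[OF residual.from_left[OF that]] by (simp add: u_def)
  have v: "0 \<le> v j" if "j \<in> V" for j
    using y[OF residual.to_right[OF that]] by (simp add: v_def)
  have inM: "u i + v j \<le> w (i, j)" if "(i, j) \<in> M" for i j
  proof -
    have "(j, i) \<notin> E" using that M(1) UV by blast
    then show ?thesis using y[OF residual.backward[OF that]] by (simp add: u_def v_def)
  qed
  have notM: "w (i, j) \<le> u i + v j" if "(i, j) \<in> E - M" for i j
    using y[OF residual.forward[OF that]] that by (simp add: u_def v_def)
  \<comment> \<open>At an unsaturated \<open>i\<close> the arc from the root forces
    \<open>u i\<close> down to 0; otherwise the degree equals \<open>b i\<close>.\<close>
  have u0: "real (b i) * u i = real (card {e \<in> M. fst e = i}) * u i" if i: "i \<in> U" for i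
  proof (cases "card {e \<in> M. fst e = i} < b i")
    case True
    then have "u i \<le> 0" using y[OF residual.to_left[OF i]] by (simp add: u_def)
    with u[OF i] show ?thesis by simp
  qed (use M(2)[OF i] in simp)
  have v0: "real (b j) * v j = real (card {e \<in> M. snd e = j}) * v j" if j: "j \<in> V" for j
  proof (cases "card {e \<in> M. snd e = j} < b j")
    case True
    then have "v j \<le> 0" using y[OF residual.from_right[OF j]] by (simp add: v_def)
    with v[OF j] show ?thesis by simp
  qed (use M(3)[OF j] in simp)
  have feas: "dual_feasible U V E w u v z"
    using u v inM notM by (auto simp: dual_feasible_def z_def algebra_simps)
  have "(\<Sum>i\<in>U. real (b i) * u i) = (\<Sum>e\<in>M. u (fst e))"
    using sum.cong[OF refl u0] sum_fibres[OF finM fin(1) sub(1), of u] by simp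
  moreover have "(\<Sum>j\<in>V. real (b j) * v j) = (\<Sum>e\<in>M. v (snd e))"
    using sum.cong[OF refl v0] sum_fibres[OF finM fin(2) sub(2), of v] by simp
  moreover have "(\<Sum>e\<in>E. z e) = (\<Sum>e\<in>M. w e - u (fst e) - v (snd e))"
    using M(1) fin(3) by (intro sum.mono_neutral_cong_right) (auto simp: z_def)
  ultimately have "dual_objective U V E b u v z = (\<Sum>e\<in>M. w e)"
    by (simp add: dual_objective_def sum_subtractf)
  with feas eq show thesis by (intro that) auto
qed

text \<open>Weak duality gives one inequality, comparison with the dual point that attains the
  matching weight the other.\<close>

lemma max_b_matching_weight_eq_dual_optimum:
  assumes "bipartite_graph U V E" "dual_optimal U V E w b u v z"
  shows "max_b_matching_weight U V E w b = dual_objective U V E b u v z"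
  using assms max_b_matching_weight_le_dual_objective dual_objective_attains_max_b_matching_weight
  unfolding dual_optimal_def by (metis order_antisym)

section \<open>Profit sharing\<close>

theorem theorem11:
  fixes U V :: "'v set" and E :: "('v \<times> 'v) set"
    and w :: "'v \<times> 'v \<Rightarrow> real" and b :: "'v \<Rightarrow> nat"
    and u v :: "'v \<Rightarrow> real" and z :: "'v \<times> 'v \<Rightarrow> real"
  assumes "bipartite_graph U V E"
    and "\<forall>e\<in>E. w e \<ge> 0"
    and "dual_optimal U V E w b u v z"
  shows "\<forall>\<alpha> \<beta>. profit_sharing_method U V E b u v z \<alpha> \<beta> \<longrightarrow> in_core U V E w b \<alpha> \<beta>"
proof (intro allI impI)
  fix \<alpha> \<beta>
  assume "profit_sharing_method U V E b u v z \<alpha> \<beta>"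
  then obtain c d where cd: "\<And>e. e \<in> E \<Longrightarrow> c e \<ge> 0 \<and> d e \<ge> 0 \<and> z e = c e + d e"
    and \<alpha>: "\<And>i. i \<in> U \<Longrightarrow> \<alpha> i = real (b i) * u i + (\<Sum>j | (i, j) \<in> E. c (i, j))"
    and \<beta>: "\<And>j. j \<in> V \<Longrightarrow> \<beta> j = real (b j) * v j + (\<Sum>i | (i, j) \<in> E. d (i, j))"
    unfolding profit_sharing_method_def by metis
  note bip = assms(1)
  note fin = bipartite_graph_finite[OF bip]
  have feas: "dual_feasible U V E w u v z" using assms(3) by (simp add: dual_optimal_def)
  have EUV: "E \<inter> U \<times> V = E" using bip by (auto simp: bipartite_graph_def)
  have fin_nbrs: "finite {j. (i, j) \<in> E}" "finite {i. (i, j) \<in> E}" for i j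
    using fin bip
    by (auto simp: bipartite_graph_def intro: finite_subset[of _ U] finite_subset[of _ V])
  \<comment> \<open>Each edge hands all of its \<open>z\<close> to its two ends, so the total is the
    same for every split.\<close>
  have "(\<Sum>i\<in>U. \<alpha> i) + (\<Sum>j\<in>V. \<beta> j) = dual_objective U V E b u v z"
    using cd sum_edges_by_vertex[OF bip]
    by (simp add: \<alpha> \<beta> sum.distrib dual_objective_def)
  then have "(\<Sum>i\<in>U. \<alpha> i) + (\<Sum>j\<in>V. \<beta> j) = worth E w b U V"
    using max_b_matching_weight_eq_dual_optimum[OF bip assms(3)] by (simp add: worth_def EUV)
  then have "imputation U V E w b \<alpha> \<beta>"
    using feas cd
    by (auto simp: imputation_def \<alpha> \<beta> dual_feasible_def intro!: add_nonneg_nonneg sum_nonneg)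
  moreover have "worth E w b Su Sv \<le> (\<Sum>i\<in>Su. \<alpha> i) + (\<Sum>j\<in>Sv. \<beta> j)"
    if S: "Su \<subseteq> U" "Sv \<subseteq> V" for Su Sv
  proof -
    let ?E = "E \<inter> Su \<times> Sv"
    have bip': "bipartite_graph Su Sv ?E" using bip S by (rule bipartite_graph_induced)
    \<comment> \<open>Feasibility survives restriction to the coalition; optimality may not, but
      weak duality asks only for feasibility.\<close>
    have "dual_feasible Su Sv ?E w u v z" using feas S by (auto simp: dual_feasible_def)
    then have "worth E w b Su Sv \<le> dual_objective Su Sv ?E b u v z"
      unfolding worth_def by (rule max_b_matching_weight_le_dual_objective[OF bip'])
    also have "\<dots> = (\<Sum>i\<in>Su. real (b i) * u i + (\<Sum>j | (i, j) \<in> ?E. c (i, j)))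
        + (\<Sum>j\<in>Sv. real (b j) * v j + (\<Sum>i | (i, j) \<in> ?E. d (i, j)))"
      using cd sum_edges_by_vertex[OF bip']
      by (simp add: sum.distrib dual_objective_def)
    \<comment> \<open>Edges leaving the coalition add nonnegative shares to its members.\<close>
    also have "\<dots> \<le> (\<Sum>i\<in>Su. real (b i) * u i + (\<Sum>j | (i, j) \<in> E. c (i, j)))
        + (\<Sum>j\<in>Sv. real (b j) * v j + (\<Sum>i | (i, j) \<in> E. d (i, j)))"
      using cd fin_nbrs by (intro add_mono sum_mono order_refl sum_mono2) auto
    also have "\<dots> = (\<Sum>i\<in>Su. \<alpha> i) + (\<Sum>j\<in>Sv. \<beta> j)"
      using S by (intro arg_cong2[where f = "(+)"] sum.cong) (auto simp: \<alpha> \<beta>)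
    finally show ?thesis .
  qed
  ultimately show "in_core U V E w b \<alpha> \<beta>" by (auto simp: in_core_def)
qed

end
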